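(* Let $p$ be a prime, let $R$ be a finite $p$-ring and let $P$ be a Sylow $p$-subgroup of $R^\circ$. Then $rk(P) \leq \alpha\, d(R^{+})$, where $\alpha =3$ if $p=2$, and $\alpha =2$ if $p>2$.
   Context: Rings are associative, not necessarily commutative or with identity. A $p$-ring is a ring $R$ whose additive group $R^+$ is a $p$-group. The circle operation on $R$ is $x\circ y=x+y+xy$; $R$ is a monoid under $\circ$ with identity $0$, and the adjoint group $R^\circ$ is the group of invertible elements of this monoid. For a group $G$, $d(G)$ is the minimal number of generators of $G$ and $rk(G)=\sup\{d(H): H \text{ a finitely generated subgroup of } G\}$ is its (Prüfer) rank. *)

theory Defs
  imports "HOL-Algebra.Algebra" "HOL-Library.Extended_Nat"
begin

text \<open>
  Associative rings, not necessarily commutative or with identity. The library's ring records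
  are reused as they are; the field \<open>one\<close> of such a record is left unconstrained and is never used.
\<close>

locale rng = abelian_group R for R (structure) +
  assumes m_closed [intro, simp]:
      "\<lbrakk>x \<in> carrier R; y \<in> carrier R\<rbrakk> \<Longrightarrow> x \<otimes> y \<in> carrier R"
    and m_assoc:
      "\<lbrakk>x \<in> carrier R; y \<in> carrier R; z \<in> carrier R\<rbrakk> \<Longrightarrow> (x \<otimes> y) \<otimes> z = x \<otimes> (y \<otimes> z)"
    and l_distr:
      "\<lbrakk>x \<in> carrier R; y \<in> carrier R; z \<in> carrier R\<rbrakk> \<Longrightarrow> (x \<oplus> y) \<otimes> z = x \<otimes> z \<oplus> y \<otimes> z"
    and r_distr:
      "\<lbrakk>x \<in> carrier R; y \<in> carrier R; z \<in> carrier R\<rbrakk> \<Longrightarrow> z \<otimes> (x \<oplus> y) = z \<otimes> x \<oplus> z \<otimes> y"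

definition p_group :: "nat \<Rightarrow> ('a, 'b) monoid_scheme \<Rightarrow> bool" where
  "p_group p G \<longleftrightarrow> group G \<and> (\<forall>x \<in> carrier G. \<exists>k. group.ord G x = p ^ k)"

definition p_ring :: "nat \<Rightarrow> ('a, 'b) ring_scheme \<Rightarrow> bool" where
  "p_ring p R \<longleftrightarrow> rng R \<and> p_group p (add_monoid R)"

definition circle_monoid :: "('a, 'b) ring_scheme \<Rightarrow> 'a monoid" where
  "circle_monoid R =
     \<lparr>carrier = carrier R, Group.monoid.mult = (\<lambda>x y. x \<oplus>\<^bsub>R\<^esub> y \<oplus>\<^bsub>R\<^esub> x \<otimes>\<^bsub>R\<^esub> y), one = \<zero>\<^bsub>R\<^esub>\<rparr>"

definition adjoint_group :: "('a, 'b) ring_scheme \<Rightarrow> 'a monoid" where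
  "adjoint_group R = units_of (circle_monoid R)"

text \<open>Only meaningful for finite \<open>G\<close>, as \<^term>\<open>Coset.order G = 0\<close> for infinite \<open>G\<close>.\<close>

definition sylow_subgroup :: "nat \<Rightarrow> ('a, 'b) monoid_scheme \<Rightarrow> 'a set \<Rightarrow> bool" where
  "sylow_subgroup p G P \<longleftrightarrow> subgroup P G \<and> card P = p ^ multiplicity p (Coset.order G)"

text \<open>
  The values are extended naturals: the infimum of the empty set is \<open>\<infinity>\<close>, so \<open>gen_number G = \<infinity>\<close>
  exactly when \<open>G\<close> is not finitely generated, and the supremum below is \<open>\<infinity>\<close> when unbounded.
\<close>

definition gen_number :: "('a, 'b) monoid_scheme \<Rightarrow> enat" where
  "gen_number G =
     (INF S \<in> {S. S \<subseteq> carrier G \<and> finite S \<and> generate G S = carrier G}. enat (card S))"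

definition finitely_generated :: "('a, 'b) monoid_scheme \<Rightarrow> bool" where
  "finitely_generated G \<longleftrightarrow> (\<exists>S \<subseteq> carrier G. finite S \<and> generate G S = carrier G)"

definition prufer_rank :: "('a, 'b) monoid_scheme \<Rightarrow> enat" where
  "prufer_rank G =
     (SUP H \<in> {H. subgroup H G \<and> finitely_generated (G\<lparr>carrier := H\<rparr>)}.
        gen_number (G\<lparr>carrier := H\<rparr>))"

lemma (in rng) l_null: "x \<in> carrier R \<Longrightarrow> \<zero> \<otimes> x = \<zero>"
  by (metis add.r_cancel_one' l_distr m_closed zero_closed r_zero)

lemma (in rng) r_null: "x \<in> carrier R \<Longrightarrow> x \<otimes> \<zero> = \<zero>"
  by (metis add.r_cancel_one' r_distr m_closed zero_closed r_zero)

lemma (in rng) monoid_circle_monoid: "monoid (circle_monoid R)"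
  by (rule monoidI)
     (auto simp: circle_monoid_def l_null r_null l_distr r_distr m_assoc a_ac)

lemma (in rng) group_adjoint_group: "group (adjoint_group R)"
  unfolding adjoint_group_def by (rule monoid.units_group[OF monoid_circle_monoid])

end

theory Submission
  imports Defs
begin

text \<open>
  Let \<open>n = d(R\<^sup>+)\<close>, and let \<open>e = 2\<close> if \<open>p = 2\<close> and \<open>e = 1\<close> otherwise. A subgroup \<open>H\<close> of
  \<open>P\<close> is cut along the ideal \<open>p\<^sup>e R\<close>: it needs at most \<open>e n\<close> generators above
  \<open>H \<inter> p\<^sup>e R\<close>, and \<open>H \<inter> p\<^sup>e R\<close> needs at most \<open>n\<close>. In total this is
  \<open>(e + 1) n\<close>, which is \<open>3 n\<close> for \<open>p = 2\<close> and \<open>2 n\<close> for odd \<open>p\<close>.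

  Both halves rest on one count: \<open>R[p] = {z. p z = 0}\<close> has as many elements as \<open>R / p R\<close>,
  hence at most \<open>p\<^sup>n\<close> (lemma \<open>card_torsion_le\<close>).

  The upper half is an index estimate. Two elements of \<open>H\<close> that are congruent modulo \<open>p\<^sup>e R\<close>
  lie in the same coset of \<open>H \<inter> p\<^sup>e R\<close>, so the index is at most \<open>|R / p\<^sup>e R|\<close>, which is at
  most \<open>p\<close> to the power \<open>e n\<close>. Every generator that is added enlarges a subgroup of a
  \<open>p\<close>-group by a factor of at least \<open>p\<close>.

  The lower half plays the role of the theory of powerful \<open>p\<close>-groups, but needs only a count.
  Within \<open>p\<^sup>e R\<close> the \<open>p\<close>-th power \<open>(1 + x)\<^sup>p - 1\<close> is close enough to \<open>p x\<close> that
  equal \<open>p\<close>-th powers force \<open>p x = p y\<close> (lemma \<open>circle_pow_eq_imp_multiple_eq\<close>). The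
  power map therefore has fibres of size at most \<open>|R[p]| \<le> p\<^sup>n\<close>, so the \<open>p\<close>-th powers
  generate a subgroup of index at most \<open>p\<^sup>n\<close> and \<open>n\<close> elements suffice to generate the
  group modulo \<open>p\<close>-th powers. By Frattini's argument \<open>p\<close>-th powers are superfluous as
  generators (lemma \<open>generate_without_powers\<close>); the maximal subgroups are normal because the
  ideals \<open>p\<^sup>i R\<close> cut out a central series.
\<close>

section \<open>Counting and generators in groups of prime power order\<close>

lemma card_le_fibre_bound_times_image:
  assumes "finite A" and "\<And>x. x \<in> A \<Longrightarrow> card {y \<in> A. f y = f x} \<le> c"
  shows "card A \<le> c * card (f ` A)"
proof -
  have "A = (\<Union>z\<in>f ` A. {y \<in> A. f y = z})"
    by auto
  then have "card A \<le> (\<Sum>z\<in>f ` A. card {y \<in> A. f y = z})"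
    using card_UN_le[of "f ` A" "\<lambda>z. {y \<in> A. f y = z}"] assms(1) by simp
  also have "\<dots> \<le> (\<Sum>z\<in>f ` A. c)"
    using assms(2) by (intro sum_mono) auto
  finally show ?thesis
    by (simp add: mult.commute)
qed

lemma (in group) card_subgroup_prime_power:
  assumes "Factorial_Ring.prime (p::nat)" "finite (carrier G)" "card (carrier G) = p ^ a" "subgroup H G"
  shows "\<exists>b. card H = p ^ b"
proof -
  have "card H dvd p ^ a"
    using lagrange[OF assms(4)] assms(3) unfolding order_def by (metis dvd_triv_right)
  then show ?thesis
    using divides_primepow_nat[OF assms(1)] by blast
qed

text \<open>
  Over a proper subgroup of a \<open>p\<close>-group, one further generator divides the index by at least
  \<open>p\<close>, because both orders are powers of \<open>p\<close>.
\<close>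
lemma (in group) generate_over_subgroup:
  assumes p: "Factorial_Ring.prime (p::nat)" and fin: "finite (carrier G)" and ca: "card (carrier G) = p ^ a"
    and N: "subgroup N G" and le: "card (carrier G) \<le> p ^ n * card N"
  shows "\<exists>S\<subseteq>carrier G. finite S \<and> card S \<le> n \<and> generate G (S \<union> N) = carrier G"
  using N le
proof (induction n arbitrary: N)
  case 0
  have "N = carrier G"
    using card_seteq[OF fin subgroup.subset[OF 0(1)]] 0(2) by simp
  then have "generate G ({} \<union> N) = carrier G"
    using generate_incl[of N] by (auto intro: generate.incl)
  then show ?case
    by (intro exI[of _ "{}"]) simp
next
  case (Suc n)
  have NG: "N \<subseteq> carrier G"
    using Suc.prems(1) by (rule subgroup.subset)
  show ?case
  proof (cases "N = carrier G")
    case True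
    then have "generate G ({} \<union> N) = carrier G"
      using generate_incl[of N] by (auto intro: generate.incl)
    then show ?thesis
      by (intro exI[of _ "{}"]) simp
  next
    case False
    then obtain x where x: "x \<in> carrier G" "x \<notin> N"
      using NG by auto
    define N' where "N' = generate G (insert x N)"
    have N': "subgroup N' G"
      unfolding N'_def using x NG by (intro generate_is_subgroup) auto
    have sub: "insert x N \<subseteq> N'"
      unfolding N'_def by (auto intro: generate.incl)
    have finN': "finite N'"
      using N' fin finite_subset subgroup.subset by blast
    obtain b where b: "card N = p ^ b"
      using card_subgroup_prime_power[OF p fin ca Suc.prems(1)] by blast
    obtain b' where b': "card N' = p ^ b'"
      using card_subgroup_prime_power[OF p fin ca N'] by blast
    have "N \<subset> N'"
      using sub x by auto
    then have "card N < card N'"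
      using finN' psubset_card_mono by blast
    then have "b < b'"
      unfolding b b' using prime_gt_1_nat[OF p] power_less_imp_less_exp by blast
    then have "p * card N \<le> card N'"
      unfolding b b' using prime_gt_1_nat[OF p] power_increasing[of "Suc b" b' p] by (simp only: power_Suc Suc_leI)
    then have "p ^ n * (p * card N) \<le> p ^ n * card N'"
      by (rule mult_le_mono2)
    moreover have "card (carrier G) \<le> p ^ n * (p * card N)"
      using Suc.prems(2) by (simp add: mult.assoc mult.left_commute)
    ultimately have "card (carrier G) \<le> p ^ n * card N'"
      by (rule order_trans[rotated])
    then obtain S where S: "S \<subseteq> carrier G" "finite S" "card S \<le> n" "generate G (S \<union> N') = carrier G"
      using Suc.IH[OF N'] by blast
    have "carrier G \<subseteq> generate G (insert x S \<union> N)"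
      unfolding S(4)[symmetric]
    proof (rule generate_subgroup_incl)
      show sg: "subgroup (generate G (insert x S \<union> N)) G"
        using S x NG by (intro generate_is_subgroup) auto
      have "N' \<subseteq> generate G (insert x S \<union> N)"
        unfolding N'_def by (rule mono_generate) auto
      then show "S \<union> N' \<subseteq> generate G (insert x S \<union> N)"
        by (auto intro: generate.incl)
    qed
    moreover have "generate G (insert x S \<union> N) \<subseteq> carrier G"
      using S x NG by (intro generate_incl) auto
    ultimately have "generate G (insert x S \<union> N) = carrier G"
      by (rule subset_antisym[rotated])
    moreover have "card (insert x S) \<le> Suc n"
      using S(2,3) by (simp add: card_insert_if)
    ultimately show ?thesis
      using S(1,2) x(1) by (intro exI[of _ "insert x S"]) simp
  qed
qed

section \<open>Frattini's argument along a central series\<close>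

text \<open>
  The last condition says that \<open>F i\<close> is central modulo \<open>F (i + 1)\<close>. The commutator
  \<open>u\<^sup>-\<^sup>1 x\<^sup>-\<^sup>1 u x\<close> is written as a quotient of the two products, because for adjoint groups
  it is their difference that can be computed.
\<close>
locale central_series = group G for G (structure) +
  fixes F :: "nat \<Rightarrow> 'a set" and m :: nat
  assumes F_0: "F 0 = carrier G"
    and F_m: "F m = {\<one>}"
    and F_carrier: "F i \<subseteq> carrier G"
    and F_inv: "x \<in> F i \<Longrightarrow> inv x \<in> F i"
    and F_comm: "\<lbrakk>x \<in> F i; u \<in> carrier G\<rbrakk> \<Longrightarrow> inv (x \<otimes> u) \<otimes> (u \<otimes> x) \<in> F (Suc i)"
begin

text \<open>
  Normalisers grow: at the last level of the series that \<open>M\<close> does not contain, commutators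
  with an element \<open>x\<close> outside \<open>M\<close> fall into the next level and hence into \<open>M\<close>. Both
  conjugations are recorded so that the normalising elements visibly form a subgroup.
\<close>
lemma subgroup_normalized_by_outside_element:
  assumes M: "subgroup M G" and ne: "M \<noteq> carrier G"
  shows "\<exists>x\<in>carrier G - M. \<forall>u\<in>M. inv x \<otimes> u \<otimes> x \<in> M \<and> x \<otimes> u \<otimes> inv x \<in> M"
proof -
  have MG: "M \<subseteq> carrier G"
    using M by (rule subgroup.subset)
  have "F m \<subseteq> M"
    using subgroup.one_closed[OF M] F_m by simp
  moreover have "\<not> F 0 \<subseteq> M"
    using F_0 ne MG by auto
  ultimately obtain i where i: "\<not> F i \<subseteq> M" "F (Suc i) \<subseteq> M"
    using nat_induct[of "\<lambda>i. \<not> F i \<subseteq> M" m] by blast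
  obtain x where x: "x \<in> F i" "x \<notin> M"
    using i by auto
  have xG: "x \<in> carrier G"
    using x F_carrier by blast
  have conj: "inv y \<otimes> u \<otimes> y \<in> M" if y: "y \<in> F i" and u: "u \<in> M" for y u
  proof -
    have yG: "y \<in> carrier G" and uG: "u \<in> carrier G"
      using y u F_carrier MG by auto
    have "inv (y \<otimes> u) \<otimes> (u \<otimes> y) \<in> M"
      using F_comm[OF y uG] i(2) by blast
    then have "u \<otimes> (inv (y \<otimes> u) \<otimes> (u \<otimes> y)) \<in> M"
      using u subgroup.m_closed[OF M] by blast
    also have "u \<otimes> (inv (y \<otimes> u) \<otimes> (u \<otimes> y)) = (u \<otimes> inv u) \<otimes> (inv y \<otimes> u \<otimes> y)"
      using yG uG by (simp only: inv_mult_group m_assoc inv_closed m_closed)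
    also have "\<dots> = inv y \<otimes> u \<otimes> y"
      using yG uG by simp
    finally show ?thesis .
  qed
  have "x \<otimes> u \<otimes> inv x \<in> M" if "u \<in> M" for u
    using conj[OF F_inv[OF x(1)] that] xG by simp
  then show ?thesis
    using conj[OF x(1)] x xG by blast
qed

text \<open>
  The normaliser is strictly larger than \<open>M\<close>, so by maximality it is the whole group.
\<close>
lemma maximal_subgroup_normal:
  assumes M: "subgroup M G" and ne: "M \<noteq> carrier G"
    and max: "\<And>N. \<lbrakk>subgroup N G; M \<subseteq> N\<rbrakk> \<Longrightarrow> N = M \<or> N = carrier G"
  shows "M \<lhd> G"
proof -
  have MG: "M \<subseteq> carrier G"
    using M by (rule subgroup.subset)
  define N where "N = {g \<in> carrier G. \<forall>u\<in>M. inv g \<otimes> u \<otimes> g \<in> M \<and> g \<otimes> u \<otimes> inv g \<in> M}"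
  have "subgroup N G"
  proof (rule subgroupI)
    show "N \<subseteq> carrier G"
      unfolding N_def by auto
    show "N \<noteq> {}"
      unfolding N_def using MG by (auto intro!: exI[of _ \<one>])
    show "inv a \<in> N" if "a \<in> N" for a
      using that unfolding N_def by auto
    show "a \<otimes> b \<in> N" if "a \<in> N" "b \<in> N" for a b
    proof -
      have aG: "a \<in> carrier G" and bG: "b \<in> carrier G"
        using that unfolding N_def by auto
      have "inv (a \<otimes> b) \<otimes> u \<otimes> (a \<otimes> b) \<in> M \<and> (a \<otimes> b) \<otimes> u \<otimes> inv (a \<otimes> b) \<in> M" if u: "u \<in> M" for u
      proof -
        have uG: "u \<in> carrier G"
          using u MG by auto
        have "inv (a \<otimes> b) \<otimes> u \<otimes> (a \<otimes> b) = inv b \<otimes> (inv a \<otimes> u \<otimes> a) \<otimes> b"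
          using aG bG uG by (simp add: inv_mult_group m_assoc)
        moreover have "(a \<otimes> b) \<otimes> u \<otimes> inv (a \<otimes> b) = a \<otimes> (b \<otimes> u \<otimes> inv b) \<otimes> inv a"
          using aG bG uG by (simp add: inv_mult_group m_assoc)
        ultimately show ?thesis
          using \<open>a \<in> N\<close> \<open>b \<in> N\<close> u unfolding N_def by auto
      qed
      then show ?thesis
        using aG bG unfolding N_def by auto
    qed
  qed
  moreover have "M \<subseteq> N"
    unfolding N_def using M MG by (auto intro: subgroup.m_closed subgroup.m_inv_closed)
  moreover have "N \<noteq> M"
    using subgroup_normalized_by_outside_element[OF M ne] unfolding N_def by blast
  ultimately have "N = carrier G"
    using max by blast
  then show ?thesis
    using M unfolding normal_inv_iff N_def by blast
qed

text \<open>
  If \<open>h\<^sup>p\<close> lay outside the normal subgroup \<open>M\<close>, then \<open>M\<close> and \<open>h\<^sup>p\<close> would generate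
  everything; writing \<open>h = u h\<^sup>p\<^sup>k\<close> with \<open>u \<in> M\<close> puts a power of \<open>h\<close> with exponent
  prime to \<open>p\<close>, and thus \<open>h\<close> itself, into \<open>M\<close>.
\<close>
lemma maximal_subgroup_pow_closed:
  fixes p :: nat
  assumes M: "subgroup M G" and ne: "M \<noteq> carrier G"
    and max: "\<And>N. \<lbrakk>subgroup N G; M \<subseteq> N\<rbrakk> \<Longrightarrow> N = M \<or> N = carrier G"
    and h: "h \<in> carrier G" and a: "h [^] (p ^ a) = \<one>"
  shows "h [^] p \<in> M"
proof (rule ccontr)
  assume hp: "h [^] p \<notin> M"
  have MG: "M \<subseteq> carrier G"
    using M by (rule subgroup.subset)
  define C where "C = generate G {h [^] p}"
  have C: "subgroup C G"
    unfolding C_def using h by (intro generate_is_subgroup) auto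
  have sg: "subgroup (M <#> C) G"
    by (rule mult_norm_subgroup[OF maximal_subgroup_normal[OF M ne max] C])
  have "M \<subseteq> M <#> C"
  proof
    fix u assume "u \<in> M"
    then show "u \<in> M <#> C"
      using subgroup.one_closed[OF C] MG unfolding set_mult_def by force
  qed
  moreover have "h [^] p \<in> M <#> C"
    using subgroup.one_closed[OF M] h unfolding set_mult_def C_def
    by (force intro: generate.incl)
  ultimately have "M <#> C = carrier G"
    using max[OF sg] hp by auto
  then have "h \<in> M <#> C"
    using h by simp
  then obtain u c where u: "u \<in> M" and "c \<in> C" and huc: "h = u \<otimes> c"
    unfolding set_mult_def by auto
  then obtain k :: int where c: "c = (h [^] p) [^] k"
    unfolding C_def using generate_pow[of "h [^] p"] h by auto
  have uG: "u \<in> carrier G"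
    using u MG by auto
  have cG: "c \<in> carrier G"
    using c h by simp
  have c': "c = h [^] (int p * k)"
    using c h by (simp add: int_pow_pow[symmetric] int_pow_int)
  have "u = h \<otimes> inv c"
    unfolding huc using uG cG by (simp add: m_assoc)
  also have "\<dots> = h [^] (1 - int p * k)"
    using int_pow_diff[OF h, of 1 "int p * k"] h unfolding c' by simp
  finally have u_pow: "u = h [^] (1 - int p * k)" .
  \<comment> \<open>\<open>1 - p k\<close> is a unit modulo the order of \<open>h\<close>, so \<open>h\<close> itself is a power of \<open>u\<close>.\<close>
  have "coprime (1 - int p * k) (int p ^ a)"
  proof -
    have "coprime (1 - int p * k) (int p)"
    proof (rule coprimeI)
      fix c assume "c dvd 1 - int p * k" "c dvd int p"
      then have "c dvd (1 - int p * k) + int p * k"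
        by (intro dvd_add) auto
      then show "is_unit c"
        by simp
    qed
    then show ?thesis
      by simp
  qed
  then obtain s t where st: "s * (1 - int p * k) + t * (int p ^ a) = 1"
    using bezout_int[of "1 - int p * k" "int p ^ a"] by auto
  have "h [^] (int p ^ a) = \<one>"
    using a int_pow_int[of G h "p ^ a"] by simp
  then have "h [^] ((int p ^ a) * t) = \<one>"
    using h by (metis int_pow_pow int_pow_one)
  moreover have "h [^] ((1 - int p * k) * s) = u [^] s"
    using h u_pow by (simp add: int_pow_pow)
  moreover have "h = h [^] ((1 - int p * k) * s + (int p ^ a) * t)"
    using h st by (simp add: mult.commute)
  ultimately have "h = u [^] s"
    using h uG by (metis int_pow_mult int_pow_closed r_one)
  then have "h \<in> M"
    using subgroup_int_pow_closed[OF M u] by simp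
  then have "h [^] p \<in> M"
    using subgroup_int_pow_closed[OF M, of h "int p"] by (simp add: int_pow_int)
  then show False
    using hp by simp
qed

text \<open>
  A proper subgroup containing \<open>S\<close> lies in a maximal one, which also contains all
  \<open>p\<close>-th powers.
\<close>
lemma generate_without_powers:
  fixes p :: nat
  assumes fin: "finite (carrier G)" and pow: "\<And>h. h \<in> carrier G \<Longrightarrow> \<exists>a. h [^] (p ^ a) = \<one>"
    and S: "S \<subseteq> carrier G"
    and gen: "generate G (S \<union> (\<lambda>h. h [^] p) ` carrier G) = carrier G"
  shows "generate G S = carrier G"
proof (rule ccontr)
  assume ne: "generate G S \<noteq> carrier G"
  define \<U> where "\<U> = {M. subgroup M G \<and> S \<subseteq> M \<and> M \<noteq> carrier G}"
  have "\<U> \<subseteq> Pow (carrier G)"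
    unfolding \<U>_def using subgroup.subset by auto
  then have "finite \<U>"
    using fin finite_subset by blast
  moreover have "generate G S \<in> \<U>"
    unfolding \<U>_def using ne S by (auto intro: generate_is_subgroup generate.incl)
  ultimately obtain M where M: "M \<in> \<U>" and max: "\<And>N. N \<in> \<U> \<Longrightarrow> M \<subseteq> N \<Longrightarrow> M = N"
    using finite_has_maximal[of \<U>] by blast
  have M': "subgroup M G" "S \<subseteq> M" "M \<noteq> carrier G"
    using M unfolding \<U>_def by auto
  have max': "N = M \<or> N = carrier G" if "subgroup N G" "M \<subseteq> N" for N
    using max[of N] that M'(2) unfolding \<U>_def by auto
  have "h [^] p \<in> M" if "h \<in> carrier G" for h
    using pow[OF that] maximal_subgroup_pow_closed[OF M'(1) M'(3) max' that] by blast
  then have "generate G (S \<union> (\<lambda>h. h [^] p) ` carrier G) \<subseteq> M"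
    using M' by (intro generate_subgroup_incl) auto
  then show False
    using gen M'(3) subgroup.subset[OF M'(1)] by auto
qed

end

section \<open>Ideals and multiples in a ring without identity\<close>

context rng
begin

lemma add_pow_mult_left:
  fixes k :: nat
  assumes "x \<in> carrier R" "y \<in> carrier R"
  shows "([k] \<cdot> x) \<otimes> y = [k] \<cdot> (x \<otimes> y)"
  using assms by (induction k) (simp_all add: l_null l_distr)

lemma add_pow_mult_right:
  fixes k :: nat
  assumes "x \<in> carrier R" "y \<in> carrier R"
  shows "x \<otimes> ([k] \<cdot> y) = [k] \<cdot> (x \<otimes> y)"
  using assms by (induction k) (simp_all add: r_null r_distr)

definition two_sided_ideal :: "'a set \<Rightarrow> bool" where
  "two_sided_ideal I \<longleftrightarrow> subgroup I (add_monoid R) \<and>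
     (\<forall>a\<in>I. \<forall>r\<in>carrier R. a \<otimes> r \<in> I \<and> r \<otimes> a \<in> I)"

lemma two_sided_idealD:
  assumes "two_sided_ideal I"
  shows "a \<in> I \<Longrightarrow> a \<in> carrier R" and "\<zero> \<in> I"
    and "a \<in> I \<Longrightarrow> b \<in> I \<Longrightarrow> a \<oplus> b \<in> I" and "a \<in> I \<Longrightarrow> \<ominus> a \<in> I"
    and "a \<in> I \<Longrightarrow> r \<in> carrier R \<Longrightarrow> a \<otimes> r \<in> I" and "a \<in> I \<Longrightarrow> r \<in> carrier R \<Longrightarrow> r \<otimes> a \<in> I"
proof -
  have I: "subgroup I (add_monoid R)"
    using assms unfolding two_sided_ideal_def by blast
  show "a \<in> I \<Longrightarrow> a \<in> carrier R"
    using subgroup.mem_carrier[OF I] by simp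
  show "\<zero> \<in> I"
    using subgroup.one_closed[OF I] by simp
  show "a \<in> I \<Longrightarrow> b \<in> I \<Longrightarrow> a \<oplus> b \<in> I"
    using subgroup.m_closed[OF I] by simp
  show "a \<in> I \<Longrightarrow> \<ominus> a \<in> I"
    using subgroup.m_inv_closed[OF I] unfolding a_inv_def .
  show "a \<in> I \<Longrightarrow> r \<in> carrier R \<Longrightarrow> a \<otimes> r \<in> I" "a \<in> I \<Longrightarrow> r \<in> carrier R \<Longrightarrow> r \<otimes> a \<in> I"
    using assms unfolding two_sided_ideal_def by blast+
qed

lemma two_sided_idealI:
  assumes "I \<subseteq> carrier R" "\<zero> \<in> I"
    and "\<And>a b. \<lbrakk>a \<in> I; b \<in> I\<rbrakk> \<Longrightarrow> a \<oplus> b \<in> I" and "\<And>a. a \<in> I \<Longrightarrow> \<ominus> a \<in> I"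
    and "\<And>a r. \<lbrakk>a \<in> I; r \<in> carrier R\<rbrakk> \<Longrightarrow> a \<otimes> r \<in> I" and "\<And>a r. \<lbrakk>a \<in> I; r \<in> carrier R\<rbrakk> \<Longrightarrow> r \<otimes> a \<in> I"
  shows "two_sided_ideal I"
proof -
  have "subgroup I (add_monoid R)"
    by (rule add.subgroupI) (use assms in auto)
  then show ?thesis
    unfolding two_sided_ideal_def using assms(5,6) by blast
qed

lemma two_sided_ideal_add_pow:
  fixes k :: nat
  assumes "two_sided_ideal I" "a \<in> I"
  shows "[k] \<cdot> a \<in> I"
proof (induction k)
  case 0
  show ?case
    using two_sided_idealD(2)[OF assms(1)] by simp
next
  case (Suc k)
  then show ?case
    using two_sided_idealD(1,3)[OF assms(1)] assms(2) by simp
qed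

definition multiples :: "nat \<Rightarrow> 'a set" where
  "multiples q = (\<lambda>x. [q] \<cdot> x) ` carrier R"

lemma two_sided_ideal_multiples: "two_sided_ideal (multiples q)"
proof (rule two_sided_idealI)
  show "a \<oplus> b \<in> multiples q" if ab: "a \<in> multiples q" "b \<in> multiples q" for a b
  proof -
    obtain x y where "x \<in> carrier R" "y \<in> carrier R" "a = [q] \<cdot> x" "b = [q] \<cdot> y"
      using ab unfolding multiples_def by auto
    then have "a \<oplus> b = [q] \<cdot> (x \<oplus> y)" "x \<oplus> y \<in> carrier R"
      by (simp_all add: add.nat_pow_distrib)
    then show ?thesis
      unfolding multiples_def by blast
  qed
  show "\<ominus> a \<in> multiples q" if a: "a \<in> multiples q" for a
  proof -
    obtain x where "x \<in> carrier R" "a = [q] \<cdot> x"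
      using a unfolding multiples_def by auto
    then have "\<ominus> a = [q] \<cdot> (\<ominus> x)" "\<ominus> x \<in> carrier R"
      by (simp_all add: add.nat_pow_inv)
    then show ?thesis
      unfolding multiples_def by blast
  qed
  show "a \<otimes> r \<in> multiples q" if "a \<in> multiples q" "r \<in> carrier R" for a r
    using that unfolding multiples_def by (auto simp: add_pow_mult_left)
  show "r \<otimes> a \<in> multiples q" if "a \<in> multiples q" "r \<in> carrier R" for a r
    using that unfolding multiples_def by (auto simp: add_pow_mult_right)
  show "\<zero> \<in> multiples q"
    unfolding multiples_def by (rule image_eqI[of _ _ \<zero>]) simp_all
qed (auto simp: multiples_def)

lemma multiples_carrier: "multiples q \<subseteq> carrier R"
  unfolding multiples_def by auto

lemma multiples_1: "multiples (Suc 0) = carrier R"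
  unfolding multiples_def by (auto simp: image_iff)

lemma multiples_add_pow: "a \<in> multiples q \<Longrightarrow> [k] \<cdot> a \<in> multiples (k * q)" for k :: nat
  unfolding multiples_def by (auto simp: add.nat_pow_pow mult.commute)

lemma multiples_dvd: "k dvd q \<Longrightarrow> multiples q \<subseteq> multiples k"
proof
  fix a assume k: "k dvd q" and "a \<in> multiples q"
  then obtain x where x: "x \<in> carrier R" "a = [q] \<cdot> x"
    unfolding multiples_def by auto
  obtain c where "q = c * k"
    using k by (metis dvdE mult.commute)
  then have "a = [k] \<cdot> ([c] \<cdot> x)"
    using x by (simp add: add.nat_pow_pow)
  then show "a \<in> multiples k"
    unfolding multiples_def using x by simp
qed

lemma multiples_mult:
  assumes "a \<in> multiples q" "b \<in> multiples r"
  shows "a \<otimes> b \<in> multiples (q * r)"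
proof -
  obtain x y where "x \<in> carrier R" "y \<in> carrier R" "a = [q] \<cdot> x" "b = [r] \<cdot> y"
    using assms unfolding multiples_def by auto
  then have "a \<otimes> b = [(q * r)] \<cdot> (x \<otimes> y)" "x \<otimes> y \<in> carrier R"
    by (simp_all add: add_pow_mult_left add_pow_mult_right add.nat_pow_pow mult.commute)
  then show ?thesis
    unfolding multiples_def by blast
qed

section \<open>Differences of powers under the circle operation\<close>

text \<open>
  In a unital extension of the ring, \<open>circle_pow x k\<close> is \<open>(1 + x)\<^sup>k - 1\<close>.
\<close>
abbreviation circle_pow :: "'a \<Rightarrow> nat \<Rightarrow> 'a" where
  "circle_pow x k \<equiv> x [^]\<^bsub>circle_monoid R\<^esub> k"

lemma one_circle_monoid: "\<one>\<^bsub>circle_monoid R\<^esub> = \<zero>"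
  by (simp add: circle_monoid_def)

lemma circle_pow_Suc: "circle_pow x (Suc k) = circle_pow x k \<oplus> x \<oplus> circle_pow x k \<otimes> x"
  by (simp add: nat_pow_def circle_monoid_def)

lemma circle_pow_mem_ideal:
  assumes "two_sided_ideal I" "x \<in> I"
  shows "circle_pow x k \<in> I"
proof (induction k)
  case 0
  show ?case
    using two_sided_idealD(2)[OF assms(1)] by (simp add: one_circle_monoid)
next
  case (Suc k)
  have "circle_pow x k \<otimes> x \<in> I"
    by (rule two_sided_idealD(5)[OF assms(1) Suc two_sided_idealD(1)[OF assms]])
  then show ?case
    unfolding circle_pow_Suc using Suc assms(2) by (intro two_sided_idealD(3)[OF assms(1)])
qed

text \<open>
  The binomial expansion of \<open>((1 + x)\<^sup>k - 1) D\<close> truncated after its linear term: all later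
  terms start with two factors from \<open>K\<close>.
\<close>
lemma circle_pow_mult_left_mod:
  assumes K: "two_sided_ideal K" and J: "two_sided_ideal J"
    and x: "x \<in> K" and D: "D \<in> carrier R"
    and KKD: "\<And>u v. \<lbrakk>u \<in> K; v \<in> K\<rbrakk> \<Longrightarrow> u \<otimes> v \<otimes> D \<in> J"
  shows "\<exists>j\<in>J. circle_pow x k \<otimes> D = [k] \<cdot> (x \<otimes> D) \<oplus> j"
proof (induction k)
  case 0
  show ?case
    using D two_sided_idealD(2)[OF J]
    by (intro bexI[of _ \<zero>]) (simp_all add: one_circle_monoid l_null)
next
  case (Suc k)
  define c where "c = circle_pow x k"
  have c: "c \<in> K"
    unfolding c_def using circle_pow_mem_ideal[OF K x] .
  note carr = two_sided_idealD(1)[OF K x] two_sided_idealD(1)[OF K c]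
  obtain j where j: "j \<in> J" "c \<otimes> D = [k] \<cdot> (x \<otimes> D) \<oplus> j"
    using Suc unfolding c_def by blast
  have jR: "j \<in> carrier R" "c \<otimes> x \<otimes> D \<in> J"
    using j(1) two_sided_idealD(1)[OF J] KKD[OF c x] by auto
  have "circle_pow x (Suc k) \<otimes> D = c \<otimes> D \<oplus> x \<otimes> D \<oplus> c \<otimes> x \<otimes> D"
    using carr D by (simp only: circle_pow_Suc c_def[symmetric] l_distr a_closed m_closed)
  also have "\<dots> = [Suc k] \<cdot> (x \<otimes> D) \<oplus> (j \<oplus> c \<otimes> x \<otimes> D)"
    using carr D jR by (simp add: j(2) a_ac)
  finally show ?case
    using two_sided_idealD(3)[OF J j(1) jR(2)] by blast
qed

text \<open>
  The noncommutative expansion of \<open>(1 + x)\<^sup>k - (1 + y)\<^sup>k\<close> for \<open>x = y + D\<close> is a sum of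
  terms \<open>(1 + x)\<^sup>i D (1 + y)\<^sup>j\<close> with \<open>i + j = k - 1\<close>. The contributions with at most one
  factor from \<open>K\<close> are \<open>k D\<close> and \<open>x D + D y\<close>, the latter occurring
  \<open>0 + 1 + \<dots> + (k - 1)\<close> times; terms with two or more factors from \<open>K\<close>, on whichever
  sides of \<open>D\<close>, go to \<open>J\<close>.
\<close>
lemma circle_pow_diff_mod:
  assumes K: "two_sided_ideal K" and J: "two_sided_ideal J"
    and x: "x \<in> K" and y: "y \<in> K" and DR: "D \<in> carrier R" and xy: "x = y \<oplus> D"
    and KKD: "\<And>u v. \<lbrakk>u \<in> K; v \<in> K\<rbrakk> \<Longrightarrow> u \<otimes> v \<otimes> D \<in> J"
    and KDK: "\<And>u v. \<lbrakk>u \<in> K; v \<in> K\<rbrakk> \<Longrightarrow> u \<otimes> D \<otimes> v \<in> J"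
    and DKK: "\<And>u v. \<lbrakk>u \<in> K; v \<in> K\<rbrakk> \<Longrightarrow> D \<otimes> u \<otimes> v \<in> J"
  shows "\<exists>j\<in>J. circle_pow x k = circle_pow y k \<oplus> ([k] \<cdot> D \<oplus> [(k choose 2)] \<cdot> (x \<otimes> D \<oplus> D \<otimes> y) \<oplus> j)"
proof (induction k)
  case 0
  show ?case
    using two_sided_idealD(1)[OF K x] two_sided_idealD(1)[OF K y] DR
      two_sided_idealD(2)[OF J] 
    by (intro bexI[of _ \<zero>]) (simp_all add: one_circle_monoid numeral_2_eq_2)
next
  case (Suc k)
  define c where "c = circle_pow x k"
  define d where "d = circle_pow y k"
  define b where "b = k choose 2"
  have c: "c \<in> K" and d: "d \<in> K"
    unfolding c_def d_def using circle_pow_mem_ideal[OF K] x y by auto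
  have xR: "x \<in> carrier R" and yR: "y \<in> carrier R" and cR: "c \<in> carrier R" and dR: "d \<in> carrier R"
    using two_sided_idealD(1)[OF K] x y c d by auto
  obtain j where j: "j \<in> J" "c = d \<oplus> ([k] \<cdot> D \<oplus> [b] \<cdot> (x \<otimes> D \<oplus> D \<otimes> y) \<oplus> j)"
    using Suc unfolding c_def d_def b_def by blast
  obtain i where i: "i \<in> J" "c \<otimes> D = [k] \<cdot> (x \<otimes> D) \<oplus> i"
    using circle_pow_mult_left_mod[OF K J x DR KKD] unfolding c_def by blast
  have jR: "j \<in> carrier R" and iR: "i \<in> carrier R"
    using i j two_sided_idealD(1)[OF J] by auto
  define E where "E = [k] \<cdot> D \<oplus> [b] \<cdot> (x \<otimes> D \<oplus> D \<otimes> y) \<oplus> j"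
  have ER: "E \<in> carrier R"
    unfolding E_def using xR yR DR jR by simp
  have cE: "c = d \<oplus> E"
    using j(2) unfolding E_def .
  define h where "h = [b] \<cdot> (x \<otimes> D \<otimes> y \<oplus> D \<otimes> y \<otimes> y) \<oplus> j \<otimes> y"
  have hJ: "h \<in> J"
    unfolding h_def
    using two_sided_idealD(3)[OF J] two_sided_ideal_add_pow[OF J] KDK[OF x y] DKK[OF y y]
      two_sided_idealD(5)[OF J j(1) yR] by blast
  have hR: "h \<in> carrier R"
    using hJ two_sided_idealD(1)[OF J] by blast
  have Ey: "E \<otimes> y = [k] \<cdot> (D \<otimes> y) \<oplus> h"
    unfolding E_def h_def using xR yR DR jR by (simp add: l_distr add_pow_mult_left a_assoc)
  have bS: "Suc k choose 2 = k + b"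
    unfolding b_def by (simp add: numeral_2_eq_2)
  have "circle_pow x (Suc k) = c \<oplus> x \<oplus> c \<otimes> x"
    unfolding c_def circle_pow_Suc ..
  also have "\<dots> = (d \<oplus> E) \<oplus> (y \<oplus> D) \<oplus> (c \<otimes> y \<oplus> c \<otimes> D)"
    using yR DR cR by (simp add: r_distr xy cE[symmetric])
  also have "c \<otimes> y = d \<otimes> y \<oplus> E \<otimes> y"
    using dR ER yR by (simp add: cE l_distr)
  also have "(d \<oplus> E) \<oplus> (y \<oplus> D) \<oplus> (d \<otimes> y \<oplus> E \<otimes> y \<oplus> c \<otimes> D)
      = (d \<oplus> y \<oplus> d \<otimes> y) \<oplus> (E \<oplus> D \<oplus> c \<otimes> D \<oplus> E \<otimes> y)"
    using dR ER yR DR cR by (simp add: a_ac)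
  also have "E \<oplus> D \<oplus> c \<otimes> D \<oplus> E \<otimes> y
      = [Suc k] \<cdot> D \<oplus> ([b] \<cdot> (x \<otimes> D \<oplus> D \<otimes> y) \<oplus> [k] \<cdot> (x \<otimes> D \<oplus> D \<otimes> y)) \<oplus> (j \<oplus> i \<oplus> h)"
    unfolding Ey i(2) unfolding E_def using xR yR DR jR iR hR
    by (simp add: add.nat_pow_distrib a_ac)
  also have "[b] \<cdot> (x \<otimes> D \<oplus> D \<otimes> y) \<oplus> [k] \<cdot> (x \<otimes> D \<oplus> D \<otimes> y) = [(Suc k choose 2)] \<cdot> (x \<otimes> D \<oplus> D \<otimes> y)"
    unfolding bS using xR yR DR by (simp add: add.nat_pow_mult add.commute)
  also have "d \<oplus> y \<oplus> d \<otimes> y = circle_pow y (Suc k)"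
    unfolding d_def circle_pow_Suc ..
  finally show ?case
    using two_sided_idealD(3)[OF J] i j hJ by blast
qed

text \<open>
  A factor \<open>p\<close> moves from \<open>u\<close> to \<open>m\<close>, where it is needed to reach the ideal.
\<close>
lemma multiples_product_with_p_divisible:
  assumes A: "[p] \<cdot> m \<in> multiples q" and m: "m \<in> carrier R" and u: "u \<in> multiples p"
  shows "u \<otimes> m \<in> multiples q" and "m \<otimes> u \<in> multiples q"
proof -
  obtain a where a: "a \<in> carrier R" "u = [p] \<cdot> a"
    using u unfolding multiples_def by auto
  have "u \<otimes> m = a \<otimes> ([p] \<cdot> m)" "m \<otimes> u = ([p] \<cdot> m) \<otimes> a"
    using a m by (simp_all add: add_pow_mult_left add_pow_mult_right)
  then show "u \<otimes> m \<in> multiples q" "m \<otimes> u \<in> multiples q"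
    using two_sided_idealD(5,6)[OF two_sided_ideal_multiples A a(1)] by simp_all
qed

text \<open>
  The exponent \<open>e\<close> for which \<open>p\<^sup>e R\<close> is deep enough that the \<open>p\<close>-th power map behaves like
  multiplication by \<open>p\<close>. For \<open>p = 2\<close> one more factor is needed, because the binomial
  coefficient \<open>p choose 2 = 1\<close> then contributes no \<open>p\<close>.
\<close>
definition depth :: "nat \<Rightarrow> nat" where
  "depth p = (if p = 2 then 2 else 1)"

lemma multiples_depth_subset: "multiples (p ^ depth p) \<subseteq> multiples p"
  by (rule multiples_dvd) (simp add: depth_def)

text \<open>
  With equal \<open>p\<close>-th powers the expansion expresses \<open>p D\<close> through terms that carry an
  additional \<open>p\<close>. Products of \<open>D\<close> with one factor from \<open>p R\<close> are multiples of \<open>q\<close>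
  already, since the \<open>p\<close> can be moved to \<open>D\<close>; a second such factor gives \<open>p q\<close>. For odd
  \<open>p\<close> the linear terms gain their \<open>p\<close> from the binomial coefficient, and for \<open>p = 2\<close> from
  the second factor \<open>2\<close> in \<open>x\<close> and \<open>y\<close>.
\<close>
lemma circle_pow_eq_imp_deeper:
  assumes p: "Factorial_Ring.prime p"
    and x: "x \<in> multiples (p ^ depth p)" and y: "y \<in> multiples (p ^ depth p)"
    and eq: "circle_pow x p = circle_pow y p"
    and D: "D \<in> carrier R" and xy: "x = y \<oplus> D" and q: "[p] \<cdot> D \<in> multiples q"
  shows "[p] \<cdot> D \<in> multiples (p * q)"
proof -
  define K where "K = multiples p"
  define J where "J = multiples (p * q)"
  have K: "two_sided_ideal K" and J: "two_sided_ideal J"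
    unfolding K_def J_def by (rule two_sided_ideal_multiples)+
  have xK: "x \<in> K" and yK: "y \<in> K"
    unfolding K_def using x y multiples_depth_subset by auto
  have KR: "K \<subseteq> carrier R"
    unfolding K_def by (rule multiples_carrier)
  have KD: "u \<otimes> D \<in> multiples q" and DK: "D \<otimes> u \<in> multiples q" if "u \<in> K" for u
    using multiples_product_with_p_divisible[OF q D, of u] that unfolding K_def by auto
  have KKD: "u \<otimes> v \<otimes> D \<in> J" if "u \<in> K" "v \<in> K" for u v
  proof -
    have "u \<otimes> (v \<otimes> D) \<in> J"
      unfolding J_def by (rule multiples_mult) (use that KD K_def in auto)
    then show ?thesis
      using that KR D by (simp add: m_assoc subset_iff)
  qed
  have KDK: "u \<otimes> D \<otimes> v \<in> J" if "u \<in> K" "v \<in> K" for u v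
    unfolding J_def mult.commute[of p q] by (rule multiples_mult) (use that KD K_def in auto)
  have DKK: "D \<otimes> u \<otimes> v \<in> J" if "u \<in> K" "v \<in> K" for u v
    unfolding J_def mult.commute[of p q] by (rule multiples_mult) (use that DK K_def in auto)
  define L where "L = x \<otimes> D \<oplus> D \<otimes> y"
  have LR: "L \<in> carrier R"
    unfolding L_def using xK yK KR D by auto
  have L: "L \<in> multiples q"
    unfolding L_def by (intro two_sided_idealD(3)[OF two_sided_ideal_multiples] KD[OF xK] DK[OF yK])
  have bL: "[(p choose 2)] \<cdot> L \<in> J"
  proof (cases "p = 2")
    case True
    have "a \<otimes> D \<in> J \<and> D \<otimes> a \<in> J" if a: "a \<in> multiples (p ^ depth p)" for a
    proof -
      obtain c where c: "c \<in> carrier R" "a = [(2 * 2 :: nat)] \<cdot> c"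
        using a True unfolding multiples_def depth_def by (auto simp: power2_eq_square)
      have "a = [p] \<cdot> ([p] \<cdot> c)"
        using c True by (simp add: add.nat_pow_pow)
      then have "a \<otimes> D = ([p] \<cdot> c) \<otimes> ([p] \<cdot> D)" "D \<otimes> a = ([p] \<cdot> D) \<otimes> ([p] \<cdot> c)"
        using c D by (simp_all add: add_pow_mult_left add_pow_mult_right)
      moreover have "[p] \<cdot> c \<in> multiples p"
        unfolding multiples_def using c by simp
      ultimately show ?thesis
        using multiples_mult[OF _ q, of "[p] \<cdot> c" p] multiples_mult[OF q, of "[p] \<cdot> c" p]
        unfolding J_def by (simp add: mult.commute)
    qed
    then have "L \<in> J"
      unfolding L_def using x y two_sided_idealD(3)[OF J] by blast
    then show ?thesis
      by (rule two_sided_ideal_add_pow[OF J])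
  next
    case False
    then have "2 < p"
      using prime_ge_2_nat[OF p] by simp
    then have "p dvd p choose 2"
      using p by (intro dvd_choose_prime) auto
    then obtain k where "p choose 2 = k * p"
      by (metis dvdE mult.commute)
    then have "[(p choose 2)] \<cdot> L = [k] \<cdot> ([p] \<cdot> L)"
      using LR by (simp add: add.nat_pow_pow mult.commute)
    then show ?thesis
      using multiples_add_pow[OF L, of p] two_sided_ideal_add_pow[OF J] unfolding J_def by simp
  qed
  obtain j where j: "j \<in> J" "circle_pow x p = circle_pow y p \<oplus> ([p] \<cdot> D \<oplus> [(p choose 2)] \<cdot> L \<oplus> j)"
    using circle_pow_diff_mod[OF K J xK yK D xy KKD KDK DKK, of p] unfolding L_def by blast
  define j' where "j' = [(p choose 2)] \<cdot> L \<oplus> j"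
  have j': "j' \<in> J" "j' \<in> carrier R"
    unfolding j'_def using two_sided_idealD(1,3)[OF J] bL j(1) by blast+
  have yp: "circle_pow y p \<in> carrier R"
    using circle_pow_mem_ideal[OF K yK] KR by blast
  have jR: "j \<in> carrier R"
    using j(1) two_sided_idealD(1)[OF J] by blast
  have "circle_pow y p \<oplus> ([p] \<cdot> D \<oplus> j') = circle_pow y p"
    using j(2) eq D LR jR unfolding j'_def by (simp add: a_assoc)
  then have "[p] \<cdot> D \<oplus> j' = \<zero>"
    using yp D j' by (simp add: add.r_cancel_one)
  then have "[p] \<cdot> D = \<ominus> j'"
    using D j' by (simp add: minus_equality)
  then show ?thesis
    using two_sided_idealD(4)[OF J j'(1)] unfolding J_def by simp
qed

text \<open>
  Iterating the previous step pushes \<open>p (x - y)\<close> into \<open>p\<^sup>i R\<close> for every \<open>i\<close>, and these ideals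
  descend to \<open>0\<close>.
\<close>
lemma circle_pow_eq_imp_multiple_eq:
  assumes p: "Factorial_Ring.prime p"
    and exp: "\<And>r. r \<in> carrier R \<Longrightarrow> [(p ^ m)] \<cdot> r = \<zero>"
    and x: "x \<in> multiples (p ^ depth p)" and y: "y \<in> multiples (p ^ depth p)"
    and eq: "circle_pow x p = circle_pow y p"
  shows "[p] \<cdot> x = [p] \<cdot> y"
proof -
  have xR: "x \<in> carrier R" and yR: "y \<in> carrier R"
    using x y multiples_carrier by auto
  define D where "D = \<ominus> y \<oplus> x"
  have D: "D \<in> carrier R" and xy: "x = y \<oplus> D"
    unfolding D_def using xR yR by (simp_all add: a_assoc[symmetric] r_neg)
  have "[p] \<cdot> D \<in> multiples (p ^ i)" for i
  proof (induction i)
    case 0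
    then show ?case
      using D by (simp add: multiples_1)
  next
    case (Suc i)
    then show ?case
      using circle_pow_eq_imp_deeper[OF p x y eq D xy] by simp
  qed
  then have "[p] \<cdot> D \<in> multiples (p ^ m)" .
  then have "[p] \<cdot> D = \<zero>"
    unfolding multiples_def using exp by auto
  then show ?thesis
    using xR yR D xy by (simp add: add.nat_pow_distrib)
qed

section \<open>Counting torsion and multiples\<close>

definition torsion :: "nat \<Rightarrow> 'a set" where
  "torsion q = {z \<in> carrier R. [q] \<cdot> z = \<zero>}"

lemma card_multiple_fibre_le:
  fixes q :: nat
  assumes fin: "finite (carrier R)" and A: "A \<subseteq> carrier R" and x: "x \<in> carrier R"
  shows "card {y \<in> A. [q] \<cdot> y = [q] \<cdot> x} \<le> card (torsion q)"
proof (rule card_inj_on_le)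
  show "inj_on (\<lambda>y. y \<oplus> \<ominus> x) {y \<in> A. [q] \<cdot> y = [q] \<cdot> x}"
    using A x by (auto simp: inj_on_def subset_iff)
  show "(\<lambda>y. y \<oplus> \<ominus> x) ` {y \<in> A. [q] \<cdot> y = [q] \<cdot> x} \<subseteq> torsion q"
    using A x unfolding torsion_def
    by (auto simp: subset_iff add.nat_pow_distrib add.nat_pow_inv r_neg)
  show "finite (torsion q)"
    unfolding torsion_def using fin by simp
qed

text \<open>
  Every fibre of multiplication by \<open>q\<close> contains a translate of \<open>R[q]\<close>.
\<close>
lemma card_torsion_times_multiples_le:
  assumes fin: "finite (carrier R)"
  shows "card (torsion q) * card (multiples q) \<le> card (carrier R)"
proof -
  define g where "g b = (SOME x. x \<in> carrier R \<and> [q] \<cdot> x = b)" for b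
  have g: "g b \<in> carrier R \<and> [q] \<cdot> g b = b" if "b \<in> multiples q" for b
    unfolding g_def by (rule someI_ex) (use that in \<open>auto simp: multiples_def\<close>)
  have "card (torsion q \<times> multiples q) \<le> card (carrier R)"
  proof (rule card_inj_on_le)
    show "inj_on (\<lambda>(z, b). z \<oplus> g b) (torsion q \<times> multiples q)"
    proof (rule inj_onI, clarify)
      fix z b z' b'
      assume z: "z \<in> torsion q" "z' \<in> torsion q" and b: "b \<in> multiples q" "b' \<in> multiples q"
        and eq: "z \<oplus> g b = z' \<oplus> g b'"
      have "[q] \<cdot> (z \<oplus> g b) = b" "[q] \<cdot> (z' \<oplus> g b') = b'"
        using z b g multiples_carrier unfolding torsion_def
        by (auto simp: add.nat_pow_distrib subset_iff)
      then have "b = b'"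
        using eq by simp
      then show "z = z' \<and> b = b'"
        using eq z g[OF b(1)] unfolding torsion_def by simp
    qed
    show "(\<lambda>(z, b). z \<oplus> g b) ` (torsion q \<times> multiples q) \<subseteq> carrier R"
      using g unfolding torsion_def by auto
  qed (rule fin)
  then show ?thesis
    by (simp add: card_cartesian_product)
qed

text \<open>
  Modulo \<open>q R\<close> every generator \<open>t\<close> contributes at most the \<open>q\<close> multiples
  \<open>0, t, \<dots>, (q - 1) t\<close>.
\<close>
lemma card_generate_over_multiples:
  assumes fin: "finite (carrier R)" and q: "0 < q" and T: "finite T" "T \<subseteq> carrier R"
  shows "card (generate (add_monoid R) (T \<union> multiples q)) \<le> q ^ card T * card (multiples q)"
  using T
proof (induction T)
  case empty
  have "generate (add_monoid R) (multiples q) \<subseteq> multiples q"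
    using two_sided_ideal_multiples unfolding two_sided_ideal_def
    by (intro add.generate_subgroup_incl) auto
  then show ?case
    using card_mono[OF finite_subset[OF multiples_carrier fin]] by simp
next
  case (insert t T)
  define N where "N = generate (add_monoid R) (T \<union> multiples q)"
  have TM: "T \<union> multiples q \<subseteq> carrier R" and t: "t \<in> carrier R"
    using insert.prems multiples_carrier by auto
  have N: "subgroup N (add_monoid R)"
    unfolding N_def using TM by (intro add.generate_is_subgroup) auto
  have NR: "N \<subseteq> carrier R"
    using subgroup.subset[OF N] by simp
  have finN: "finite N"
    using NR fin finite_subset by blast
  have N0: "\<zero> \<in> N" and Nadd: "\<And>a b. \<lbrakk>a \<in> N; b \<in> N\<rbrakk> \<Longrightarrow> a \<oplus> b \<in> N" and Nminus: "\<And>a. a \<in> N \<Longrightarrow> \<ominus> a \<in> N"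
    using subgroup.one_closed[OF N] subgroup.m_closed[OF N] subgroup.m_inv_closed[OF N]
    by (simp_all add: a_inv_def)
  have qN: "[q] \<cdot> a \<in> N" if "a \<in> carrier R" for a
    unfolding N_def using that by (auto intro!: generate.incl simp: multiples_def)
  define Y where "Y = (\<Union>i::nat. (\<lambda>n. [i] \<cdot> t \<oplus> n) ` N)"
  have YI: "[i] \<cdot> t \<oplus> n \<in> Y" if "n \<in> N" for i :: nat and n
    unfolding Y_def using that by blast
  have YE: "\<exists>(i::nat) n. n \<in> N \<and> a = [i] \<cdot> t \<oplus> n" if "a \<in> Y" for a
    using that unfolding Y_def by (elim UN_E imageE) blast
  have Y: "subgroup Y (add_monoid R)"
  proof (rule add.subgroupI)
    show "Y \<subseteq> carrier R"
      unfolding Y_def using t NR by auto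
    show "Y \<noteq> {}"
      using YI[OF N0] by blast
    show "a \<oplus> b \<in> Y" if ab: "a \<in> Y" "b \<in> Y" for a b
    proof -
      obtain i :: nat and n where i: "n \<in> N" "a = [i] \<cdot> t \<oplus> n"
        using YE[OF ab(1)] by blast
      obtain j :: nat and k where j: "k \<in> N" "b = [j] \<cdot> t \<oplus> k"
        using YE[OF ab(2)] by blast
      have nk: "n \<in> carrier R" "k \<in> carrier R"
        using i(1) j(1) NR by auto
      have "a \<oplus> b = ([i] \<cdot> t \<oplus> [j] \<cdot> t) \<oplus> (n \<oplus> k)"
        unfolding i(2) j(2) using nk t by (simp add: a_ac)
      also have "[i] \<cdot> t \<oplus> [j] \<cdot> t = [(i + j)] \<cdot> t"
        using t by (simp add: add.nat_pow_mult)
      finally show ?thesis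
        using YI[OF Nadd[OF i(1) j(1)], of "i + j"] by simp
    qed
    show "\<ominus> a \<in> Y" if a: "a \<in> Y" for a
    proof -
      obtain i :: nat and n where i: "n \<in> N" "a = [i] \<cdot> t \<oplus> n"
        using YE[OF a] by blast
      define s where "s = [i] \<cdot> t"
      have s: "s \<in> carrier R" and n: "n \<in> carrier R"
        unfolding s_def using t i(1) NR by auto
      \<comment> \<open>As \<open>q s\<close> lies in \<open>N\<close>, the element \<open>-s\<close> agrees with \<open>(q - 1) s\<close> up to \<open>N\<close>.\<close>
      have "[(q - 1)] \<cdot> s \<oplus> s = [q] \<cdot> s"
        using q add.nat_pow_Suc[of "q - 1" s] by simp
      then have "\<ominus> ([q] \<cdot> s) = \<ominus> ([(q - 1)] \<cdot> s \<oplus> s)"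
        by simp
      also have "\<dots> = \<ominus> ([(q - 1)] \<cdot> s) \<oplus> \<ominus> s"
        by (rule minus_add) (use s in simp_all)
      finally have neg: "\<ominus> ([q] \<cdot> s) = \<ominus> ([(q - 1)] \<cdot> s) \<oplus> \<ominus> s" .
      have "[(q - 1)] \<cdot> s \<oplus> (\<ominus> ([q] \<cdot> s) \<oplus> \<ominus> n)
          = ([(q - 1)] \<cdot> s \<oplus> \<ominus> ([(q - 1)] \<cdot> s)) \<oplus> (\<ominus> s \<oplus> \<ominus> n)"
        unfolding neg using s n by (simp add: a_assoc)
      also have "\<dots> = \<ominus> a"
        unfolding i(2) s_def[symmetric] using s n by (simp add: r_neg minus_add)
      finally have "\<ominus> a = [(i * (q - 1))] \<cdot> t \<oplus> (\<ominus> ([q] \<cdot> s) \<oplus> \<ominus> n)"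
        unfolding s_def using t by (simp add: add.nat_pow_pow mult.commute)
      then show ?thesis
        using YI[OF Nadd[OF Nminus[OF qN[OF s]] Nminus[OF i(1)]], of "i * (q - 1)"] by simp
    qed
  qed
  have "insert t T \<union> multiples q \<subseteq> Y"
  proof -
    have "t \<in> Y"
      using YI[OF N0, of "Suc 0"] t by simp
    moreover have "N \<subseteq> Y"
    proof
      fix n assume n: "n \<in> N"
      then show "n \<in> Y"
        using YI[OF n, of 0] NR by (simp add: subset_iff)
    qed
    moreover have "T \<union> multiples q \<subseteq> N"
      unfolding N_def by (auto intro: generate.incl)
    ultimately show ?thesis
      by auto
  qed
  then have "generate (add_monoid R) (insert t T \<union> multiples q) \<subseteq> Y"
    using Y by (rule add.generate_subgroup_incl)
  also have "Y \<subseteq> (\<lambda>(i, n). [i] \<cdot> t \<oplus> n) ` ({..<q} \<times> N)"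
  proof
    fix a assume "a \<in> Y"
    then obtain i :: nat and n where i: "n \<in> N" "a = [i] \<cdot> t \<oplus> n"
      using YE by blast
    define s where "s = [q] \<cdot> ([(i div q)] \<cdot> t)"
    have sN: "s \<in> N"
      unfolding s_def using qN t by simp
    have "[i] \<cdot> t = [(i mod q + (i div q) * q)] \<cdot> t"
      by simp
    also have "\<dots> = [(i mod q)] \<cdot> t \<oplus> s"
      unfolding s_def using t by (simp only: add.nat_pow_mult[symmetric] add.nat_pow_pow)
    finally have "a = [(i mod q)] \<cdot> t \<oplus> (s \<oplus> n)"
      using i sN NR t by (simp add: a_assoc subset_iff)
    then show "a \<in> (\<lambda>(i, n). [i] \<cdot> t \<oplus> n) ` ({..<q} \<times> N)"
      using Nadd[OF sN i(1)] q by (intro image_eqI[of _ _ "(i mod q, s \<oplus> n)"]) auto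
  qed
  finally have "card (generate (add_monoid R) (insert t T \<union> multiples q))
      \<le> card ((\<lambda>(i, n). [i] \<cdot> t \<oplus> n) ` ({..<q} \<times> N))"
    using finN by (intro card_mono) auto
  also have "\<dots> \<le> q * card N"
    using card_image_le[of "{..<q} \<times> N" "\<lambda>(i, n). [i] \<cdot> t \<oplus> n"] finN
    by (simp add: card_cartesian_product)
  also have "\<dots> \<le> q * (q ^ card T * card (multiples q))"
    using insert unfolding N_def by simp
  finally show ?case
    using insert by (simp add: mult.assoc)
qed

lemma card_torsion_le:
  assumes fin: "finite (carrier R)" and q: "0 < q"
    and T: "finite T" "T \<subseteq> carrier R" "generate (add_monoid R) T = carrier R"
  shows "card (torsion q) \<le> q ^ card T"
proof -
  have "carrier R \<subseteq> generate (add_monoid R) (T \<union> multiples q)"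
    using add.mono_generate[of T "T \<union> multiples q"] T(3) by auto
  moreover have "generate (add_monoid R) (T \<union> multiples q) \<subseteq> carrier R"
    using add.generate_incl[of "T \<union> multiples q"] T(2) multiples_carrier by auto
  ultimately have "card (carrier R) \<le> q ^ card T * card (multiples q)"
    using card_generate_over_multiples[OF fin q T(1,2)] by simp
  then have "card (torsion q) * card (multiples q) \<le> q ^ card T * card (multiples q)"
    using card_torsion_times_multiples_le[OF fin, of q] by (rule order_trans[rotated])
  moreover have "0 < card (multiples q)"
    unfolding multiples_def card_gt_0_iff using fin zero_closed by blast
  ultimately show ?thesis
    by simp
qed

text \<open>
  Each step from \<open>p\<^sup>i R\<close> to \<open>p\<^sup>i\<^sup>+\<^sup>1 R\<close> is multiplication by \<open>p\<close>, whose fibres have at most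
  \<open>|R[p]|\<close> elements.
\<close>
lemma card_carrier_le_multiples:
  assumes fin: "finite (carrier R)" and tor: "card (torsion p) \<le> c"
  shows "card (carrier R) \<le> c ^ e * card (multiples (p ^ e))"
proof (induction e)
  case 0
  then show ?case
    by (simp add: multiples_1)
next
  case (Suc e)
  have "card (multiples (p ^ e)) \<le> c * card ((\<lambda>x. [p] \<cdot> x) ` multiples (p ^ e))"
  proof (rule card_le_fibre_bound_times_image)
    show "finite (multiples (p ^ e))"
      using fin multiples_carrier finite_subset by blast
    show "card {y \<in> multiples (p ^ e). [p] \<cdot> y = [p] \<cdot> x} \<le> c" if "x \<in> multiples (p ^ e)" for x
      using card_multiple_fibre_le[OF fin multiples_carrier, of x] that multiples_carrier tor
      by (meson order_trans subsetD)
  qed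
  also have "(\<lambda>x. [p] \<cdot> x) ` multiples (p ^ e) = multiples (p ^ Suc e)"
    unfolding multiples_def by (auto simp: image_image add.nat_pow_pow mult.commute)
  finally have "card (carrier R) \<le> c ^ e * (c * card (multiples (p ^ Suc e)))"
    by (rule order_trans[OF Suc mult_le_mono2])
  then show ?case
    by (simp add: mult.assoc mult.left_commute)
qed

section \<open>Subgroups of the adjoint group\<close>

lemma one_adjoint_group: "\<one>\<^bsub>adjoint_group R\<^esub> = \<zero>"
  by (simp add: adjoint_group_def units_of_def circle_monoid_def)

lemma mult_adjoint_group: "x \<otimes>\<^bsub>adjoint_group R\<^esub> y = x \<oplus> y \<oplus> x \<otimes> y"
  by (simp add: adjoint_group_def units_of_def circle_monoid_def)

lemma adjoint_group_carrier: "carrier (adjoint_group R) \<subseteq> carrier R"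
  by (auto simp: adjoint_group_def units_of_def circle_monoid_def Units_def)

lemma pow_adjoint_group: "x [^]\<^bsub>adjoint_group R\<lparr>carrier := H\<rparr>\<^esub> (k::nat) = circle_pow x k"
  by (simp add: nat_pow_def adjoint_group_def units_of_def)

text \<open>
  In the unital extension this is \<open>(1 + b)\<^sup>-\<^sup>1 (1 + b + d) = 1 + (1 + b)\<^sup>-\<^sup>1 d\<close>. It makes
  additive congruence modulo an ideal imply congruence of adjoint cosets.
\<close>
lemma adjoint_quotient_mem_ideal:
  assumes I: "two_sided_ideal I" and a: "a \<in> carrier (adjoint_group R)" and b: "b \<in> carrier (adjoint_group R)"
    and ab: "a = b \<oplus> d" and d: "d \<in> I"
  shows "inv\<^bsub>adjoint_group R\<^esub> b \<otimes>\<^bsub>adjoint_group R\<^esub> a \<in> I"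
proof -
  interpret A: group "adjoint_group R"
    by (rule group_adjoint_group)
  define c where "c = inv\<^bsub>adjoint_group R\<^esub> b"
  have R: "c \<in> carrier R" "b \<in> carrier R" "d \<in> carrier R"
    unfolding c_def using b A.inv_closed[OF b] adjoint_group_carrier two_sided_idealD(1)[OF I d] by auto
  have cb: "c \<oplus> b \<oplus> c \<otimes> b = \<zero>"
    using A.l_inv[OF b] unfolding c_def mult_adjoint_group one_adjoint_group .
  have "c \<otimes>\<^bsub>adjoint_group R\<^esub> a = (c \<oplus> b \<oplus> c \<otimes> b) \<oplus> (d \<oplus> c \<otimes> d)"
    unfolding mult_adjoint_group ab using R by (simp add: r_distr a_ac)
  also have "\<dots> = d \<oplus> c \<otimes> d"
    unfolding cb using R by simp
  finally show ?thesis
    unfolding c_def[symmetric] using two_sided_idealD(3)[OF I d two_sided_idealD(6)[OF I d R(1)]] by simp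
qed

lemma adjoint_subgroup_inter_ideal:
  assumes I: "two_sided_ideal I" and H: "subgroup H (adjoint_group R)"
  shows "subgroup (H \<inter> I) (adjoint_group R)"
proof -
  interpret A: group "adjoint_group R"
    by (rule group_adjoint_group)
  note HG = subgroup.mem_carrier[OF H]
  show ?thesis
  proof (rule A.subgroupI)
    show "H \<inter> I \<subseteq> carrier (adjoint_group R)"
      using HG by auto
    show "H \<inter> I \<noteq> {}"
      using subgroup.one_closed[OF H] two_sided_idealD(2)[OF I] one_adjoint_group by auto
    show "inv\<^bsub>adjoint_group R\<^esub> a \<in> H \<inter> I" if a: "a \<in> H \<inter> I" for a
    proof -
      have aG: "a \<in> carrier (adjoint_group R)" and aR: "a \<in> carrier R"
        using a HG two_sided_idealD(1)[OF I] by auto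
      \<comment> \<open>The inverse of \<open>a\<close> is the quotient of \<open>0\<close> by \<open>a\<close>, and \<open>0\<close> is congruent to \<open>a\<close> modulo \<open>I\<close>.\<close>
      have zG: "\<zero> \<in> carrier (adjoint_group R)"
        using A.one_closed unfolding one_adjoint_group .
      have az: "\<zero> = a \<oplus> \<ominus> a"
        using aR by (simp add: r_neg)
      have "\<ominus> a \<in> I"
        using a by (intro two_sided_idealD(4)[OF I]) simp
      then have "inv\<^bsub>adjoint_group R\<^esub> a \<otimes>\<^bsub>adjoint_group R\<^esub> \<zero> \<in> I"
        by (rule adjoint_quotient_mem_ideal[OF I zG aG az])
      then have "inv\<^bsub>adjoint_group R\<^esub> a \<in> I"
        using A.r_one[OF A.inv_closed[OF aG]] unfolding one_adjoint_group by simp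
      then show ?thesis
        using a subgroup.m_inv_closed[OF H] by simp
    qed
    show "a \<otimes>\<^bsub>adjoint_group R\<^esub> b \<in> H \<inter> I" if ab: "a \<in> H \<inter> I" "b \<in> H \<inter> I" for a b
    proof -
      have aI: "a \<in> I" and bI: "b \<in> I"
        using ab by auto
      have "a \<oplus> b \<oplus> a \<otimes> b \<in> I"
        by (intro two_sided_idealD(3)[OF I] two_sided_idealD(5)[OF I aI] aI bI two_sided_idealD(1)[OF I bI])
      then show ?thesis
        using ab subgroup.m_closed[OF H] by (simp add: mult_adjoint_group)
    qed
  qed
qed

lemma card_adjoint_subgroup_le:
  assumes fin: "finite (carrier R)" and I: "two_sided_ideal I" and H: "subgroup H (adjoint_group R)"
  shows "card H * card I \<le> card (H \<inter> I) * card (carrier R)"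
proof -
  interpret A: group "adjoint_group R"
    by (rule group_adjoint_group)
  have HG: "H \<subseteq> carrier (adjoint_group R)"
    using subgroup.subset[OF H] .
  then have HR: "H \<subseteq> carrier R"
    using adjoint_group_carrier by auto
  have finH: "finite H"
    using HR fin finite_subset by blast
  have I': "subgroup I (add_monoid R)"
    using I unfolding two_sided_ideal_def by simp
  define f where "f = (\<lambda>x. I #>\<^bsub>add_monoid R\<^esub> x)"
  have "card H \<le> card (H \<inter> I) * card (f ` H)"
  proof (rule card_le_fibre_bound_times_image[OF finH])
    fix x assume x: "x \<in> H"
    have xG: "x \<in> carrier (adjoint_group R)" and xR: "x \<in> carrier R"
      using x HG HR by auto
    show "card {y \<in> H. f y = f x} \<le> card (H \<inter> I)"
    proof (rule card_inj_on_le)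
      show "inj_on (\<lambda>y. inv\<^bsub>adjoint_group R\<^esub> x \<otimes>\<^bsub>adjoint_group R\<^esub> y) {y \<in> H. f y = f x}"
        using xG HG by (auto simp: inj_on_def subset_iff)
      show "(\<lambda>y. inv\<^bsub>adjoint_group R\<^esub> x \<otimes>\<^bsub>adjoint_group R\<^esub> y) ` {y \<in> H. f y = f x} \<subseteq> H \<inter> I"
      proof (clarify, intro IntI)
        fix y assume y: "y \<in> H" "f y = f x"
        have yG: "y \<in> carrier (adjoint_group R)" and yR: "y \<in> carrier R"
          using y HG HR by auto
        have "y \<in> I #>\<^bsub>add_monoid R\<^esub> x"
          using add.rcos_self[OF yR I'] y(2) unfolding f_def by simp
        then obtain d where d: "d \<in> I" "y = d \<oplus> x"
          unfolding r_coset_def by auto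
        have "y = x \<oplus> d"
          using d two_sided_idealD(1)[OF I] xR by (simp add: a_comm)
        then show "inv\<^bsub>adjoint_group R\<^esub> x \<otimes>\<^bsub>adjoint_group R\<^esub> y \<in> I"
          using adjoint_quotient_mem_ideal[OF I yG xG _ d(1)] by blast
        show "inv\<^bsub>adjoint_group R\<^esub> x \<otimes>\<^bsub>adjoint_group R\<^esub> y \<in> H"
          using x y H by (simp add: subgroup.m_closed subgroup.m_inv_closed)
      qed
    qed (use finH in simp)
  qed
  moreover have "card (f ` H) \<le> card (rcosets\<^bsub>add_monoid R\<^esub> I)"
  proof (rule card_mono)
    show "finite (rcosets\<^bsub>add_monoid R\<^esub> I)"
      unfolding RCOSETS_def using fin by simp
    show "f ` H \<subseteq> rcosets\<^bsub>add_monoid R\<^esub> I"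
      unfolding RCOSETS_def f_def using HR by auto
  qed
  ultimately have "card H \<le> card (H \<inter> I) * card (rcosets\<^bsub>add_monoid R\<^esub> I)"
    using order_trans mult_le_mono2 by blast
  then have "card H * card I \<le> card (H \<inter> I) * (card (rcosets\<^bsub>add_monoid R\<^esub> I) * card I)"
    using mult_le_mono1[of "card H" _ "card I"] by (simp add: mult.assoc)
  then show ?thesis
    using add.lagrange[OF I'] by (simp add: order_def)
qed

text \<open>
  The products \<open>u \<circ> x\<close> and \<open>x \<circ> u\<close> differ by \<open>u x - x u\<close>, which gains a factor \<open>p\<close>
  over \<open>x\<close> because \<open>u \<in> p R\<close>.
\<close>
lemma central_series_multiples:
  assumes exp: "\<And>r. r \<in> carrier R \<Longrightarrow> [(p ^ m)] \<cdot> r = \<zero>"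
    and H: "subgroup H (adjoint_group R)" and Hp: "H \<subseteq> multiples p"
  shows "central_series (adjoint_group R\<lparr>carrier := H\<rparr>) (\<lambda>i. H \<inter> multiples (p ^ i)) m"
proof -
  interpret A: group "adjoint_group R"
    by (rule group_adjoint_group)
  have HG: "H \<subseteq> carrier (adjoint_group R)"
    using subgroup.subset[OF H] .
  have HR: "H \<subseteq> carrier R"
    using HG adjoint_group_carrier by auto
  interpret B: group "adjoint_group R\<lparr>carrier := H\<rparr>"
    by (rule A.subgroup_imp_group[OF H])
  have inv_eq: "inv\<^bsub>adjoint_group R\<lparr>carrier := H\<rparr>\<^esub> x = inv\<^bsub>adjoint_group R\<^esub> x" if "x \<in> H" for x
    using A.m_inv_consistent[OF H that] .
  show ?thesis
  proof unfold_locales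
    show "H \<inter> multiples (p ^ 0) = carrier (adjoint_group R\<lparr>carrier := H\<rparr>)"
      using HR by (auto simp: multiples_1)
    have "multiples (p ^ m) \<subseteq> {\<zero>}"
      unfolding multiples_def using exp by auto
    then show "H \<inter> multiples (p ^ m) = {\<one>\<^bsub>adjoint_group R\<lparr>carrier := H\<rparr>\<^esub>}"
      using subgroup.one_closed[OF H] two_sided_idealD(2)[OF two_sided_ideal_multiples]
      by (auto simp: one_adjoint_group)
    show "H \<inter> multiples (p ^ i) \<subseteq> carrier (adjoint_group R\<lparr>carrier := H\<rparr>)" for i
      by simp
    show "inv\<^bsub>adjoint_group R\<lparr>carrier := H\<rparr>\<^esub> x \<in> H \<inter> multiples (p ^ i)"
      if "x \<in> H \<inter> multiples (p ^ i)" for x i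
      using subgroup.m_inv_closed[OF adjoint_subgroup_inter_ideal[OF two_sided_ideal_multiples H] that]
        that inv_eq by simp
    show "inv\<^bsub>adjoint_group R\<lparr>carrier := H\<rparr>\<^esub> (x \<otimes>\<^bsub>adjoint_group R\<lparr>carrier := H\<rparr>\<^esub> u)
        \<otimes>\<^bsub>adjoint_group R\<lparr>carrier := H\<rparr>\<^esub> (u \<otimes>\<^bsub>adjoint_group R\<lparr>carrier := H\<rparr>\<^esub> x)
        \<in> H \<inter> multiples (p ^ Suc i)"
      if x: "x \<in> H \<inter> multiples (p ^ i)" and "u \<in> carrier (adjoint_group R\<lparr>carrier := H\<rparr>)" for x u i
    proof -
      note I = two_sided_ideal_multiples[of "p ^ Suc i"]
      have xH: "x \<in> H" and u: "u \<in> H"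
        using that by auto
      define a where "a = u \<otimes>\<^bsub>adjoint_group R\<^esub> x"
      define b where "b = x \<otimes>\<^bsub>adjoint_group R\<^esub> u"
      have ab: "a \<in> H" "b \<in> H"
        unfolding a_def b_def using xH u subgroup.m_closed[OF H] by auto
      have R: "x \<in> carrier R" "u \<in> carrier R"
        using xH u HR by auto
      define d where "d = u \<otimes> x \<oplus> \<ominus> (x \<otimes> u)"
      have "x \<otimes> u \<in> multiples (p ^ Suc i)" "u \<otimes> x \<in> multiples (p ^ Suc i)"
        using multiples_mult[of x "p ^ i" u p] multiples_mult[of u p x "p ^ i"] x u Hp
        by (auto simp: mult.commute)
      then have d: "d \<in> multiples (p ^ Suc i)"
        unfolding d_def by (intro two_sided_idealD(3,4)[OF I])
      have "b \<oplus> d = x \<oplus> u \<oplus> (x \<otimes> u \<oplus> \<ominus> (x \<otimes> u)) \<oplus> u \<otimes> x"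
        unfolding b_def d_def mult_adjoint_group using R by (simp add: a_ac)
      also have "\<dots> = a"
        unfolding a_def mult_adjoint_group using R by (simp add: r_neg a_comm)
      finally have "a = b \<oplus> d" ..
      then have "inv\<^bsub>adjoint_group R\<^esub> b \<otimes>\<^bsub>adjoint_group R\<^esub> a \<in> multiples (p ^ Suc i)"
        using ab HG by (intro adjoint_quotient_mem_ideal[OF I _ _ _ d]) auto
      moreover have "inv\<^bsub>adjoint_group R\<^esub> b \<otimes>\<^bsub>adjoint_group R\<^esub> a \<in> H"
        using ab H by (simp add: subgroup.m_closed subgroup.m_inv_closed)
      ultimately show ?thesis
        using inv_eq[OF ab(2)] unfolding a_def b_def by simp
    qed
  qed
qed

text \<open>
  The fibres of the \<open>p\<close>-th power map are no larger than \<open>R[p]\<close>, so the subgroup generated by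
  the \<open>p\<close>-th powers has index at most \<open>p\<^sup>n\<close>, and it can be dropped from any generating
  set by Frattini's argument.
\<close>
lemma deep_adjoint_subgroup_generators:
  assumes p: "Factorial_Ring.prime p" and fin: "finite (carrier R)"
    and exp: "\<And>r. r \<in> carrier R \<Longrightarrow> [(p ^ m)] \<cdot> r = \<zero>"
    and tor: "card (torsion p) \<le> p ^ n"
    and H: "subgroup H (adjoint_group R)" and Hp: "H \<subseteq> multiples (p ^ depth p)"
    and ca: "card H = p ^ a"
  shows "\<exists>S\<subseteq>H. finite S \<and> card S \<le> n \<and> generate (adjoint_group R) S = H"
proof -
  interpret A: group "adjoint_group R"
    by (rule group_adjoint_group)
  define G where "G = adjoint_group R\<lparr>carrier := H\<rparr>"
  have cG: "carrier G = H"
    unfolding G_def by simp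
  interpret C: central_series G "\<lambda>i. H \<inter> multiples (p ^ i)" m
    unfolding G_def using Hp multiples_depth_subset by (intro central_series_multiples[OF exp H]) auto
  have HR: "H \<subseteq> carrier R"
    using Hp multiples_carrier by auto
  have finH: "finite H"
    using HR fin finite_subset by blast
  define Q where "Q = (\<lambda>h. h [^]\<^bsub>G\<^esub> p) ` H"
  have QH: "Q \<subseteq> H"
    unfolding Q_def using C.nat_pow_closed cG by auto
  have "card H \<le> p ^ n * card Q"
    unfolding Q_def
  proof (rule card_le_fibre_bound_times_image[OF finH])
    fix x assume x: "x \<in> H"
    have "{y \<in> H. y [^]\<^bsub>G\<^esub> p = x [^]\<^bsub>G\<^esub> p} \<subseteq> {y \<in> H. [p] \<cdot> y = [p] \<cdot> x}"
      using circle_pow_eq_imp_multiple_eq[OF p exp] x Hp by (auto simp: G_def pow_adjoint_group)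
    then have "card {y \<in> H. y [^]\<^bsub>G\<^esub> p = x [^]\<^bsub>G\<^esub> p} \<le> card {y \<in> H. [p] \<cdot> y = [p] \<cdot> x}"
      using finH by (intro card_mono) auto
    also have "\<dots> \<le> card (torsion p)"
      using x HR by (intro card_multiple_fibre_le[OF fin]) auto
    finally show "card {y \<in> H. y [^]\<^bsub>G\<^esub> p = x [^]\<^bsub>G\<^esub> p} \<le> p ^ n"
      using tor by simp
  qed
  also have "\<dots> \<le> p ^ n * card (generate G Q)"
  proof -
    have "generate G Q \<subseteq> H"
      using C.generate_incl[of Q] QH cG by simp
    then have "card Q \<le> card (generate G Q)"
      using finH finite_subset by (intro card_mono) (auto intro: generate.incl)
    then show ?thesis
      by simp
  qed
  finally obtain S where S: "S \<subseteq> H" "finite S" "card S \<le> n" "generate G (S \<union> generate G Q) = H"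
    using C.generate_over_subgroup[OF p, of a "generate G Q" n] C.generate_is_subgroup[of Q]
    unfolding cG using finH ca QH by blast
  have "H \<subseteq> generate G (S \<union> Q)"
  proof -
    have "subgroup (generate G (S \<union> Q)) G"
      using S(1) QH cG by (intro C.generate_is_subgroup) auto
    moreover have "S \<union> generate G Q \<subseteq> generate G (S \<union> Q)"
      using C.mono_generate[of Q "S \<union> Q"] by (auto intro: generate.incl)
    ultimately have "generate G (S \<union> generate G Q) \<subseteq> generate G (S \<union> Q)"
      by (intro C.generate_subgroup_incl)
    then show ?thesis
      using S(4) by simp
  qed
  moreover have "generate G (S \<union> Q) \<subseteq> H"
    using C.generate_incl[of "S \<union> Q"] S(1) QH cG by simp
  ultimately have "generate G (S \<union> (\<lambda>h. h [^]\<^bsub>G\<^esub> p) ` carrier G) = carrier G"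
    unfolding Q_def cG by simp
  moreover have "\<exists>a. h [^]\<^bsub>G\<^esub> (p ^ a) = \<one>\<^bsub>G\<^esub>" if "h \<in> carrier G" for h
    using C.pow_order_eq_1[OF that] ca unfolding order_def cG by auto
  ultimately have "generate G S = H"
    using C.generate_without_powers[of p S] S(1) finH cG by simp
  then have "generate (adjoint_group R) S = H"
    unfolding G_def using A.generate_consistent[OF S(1) H] by simp
  then show ?thesis
    using S by blast
qed

text \<open>
  For \<open>e = depth p\<close>, the index of \<open>H \<inter> p\<^sup>e R\<close> in \<open>H\<close> is at most \<open>|R / p\<^sup>e R|\<close> and hence at
  most \<open>p\<close> to the power \<open>e n\<close>; this costs \<open>e n\<close> generators on top of the \<open>n\<close> below.
\<close>
lemma adjoint_subgroup_generators:
  assumes p: "Factorial_Ring.prime p" and fin: "finite (carrier R)"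
    and exp: "\<And>r. r \<in> carrier R \<Longrightarrow> [(p ^ m)] \<cdot> r = \<zero>"
    and tor: "card (torsion p) \<le> p ^ n"
    and H: "subgroup H (adjoint_group R)" and ca: "card H = p ^ a"
  shows "\<exists>S\<subseteq>H. finite S \<and> card S \<le> (depth p + 1) * n \<and> generate (adjoint_group R) S = H"
proof -
  interpret A: group "adjoint_group R"
    by (rule group_adjoint_group)
  define I where "I = multiples (p ^ depth p)"
  have I: "two_sided_ideal I"
    unfolding I_def by (rule two_sided_ideal_multiples)
  define G where "G = adjoint_group R\<lparr>carrier := H\<rparr>"
  have cG: "carrier G = H"
    unfolding G_def by simp
  interpret G: group G
    unfolding G_def by (rule A.subgroup_imp_group[OF H])
  have HR: "H \<subseteq> carrier R"
    using subgroup.subset[OF H] adjoint_group_carrier by auto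
  have finH: "finite H"
    using HR fin finite_subset by blast
  have HI: "subgroup (H \<inter> I) (adjoint_group R)"
    by (rule adjoint_subgroup_inter_ideal[OF I H])
  have HI': "subgroup (H \<inter> I) G"
    unfolding G_def by (rule A.subgroup_incl[OF HI H]) auto
  obtain b where "card (H \<inter> I) = p ^ b"
    using G.card_subgroup_prime_power[OF p _ _ HI'] finH ca cG by auto
  then have "\<exists>S\<subseteq>H \<inter> I. finite S \<and> card S \<le> n \<and> generate (adjoint_group R) S = H \<inter> I"
    by (intro deep_adjoint_subgroup_generators[OF p fin exp tor HI]) (auto simp: I_def)
  then obtain S where S: "S \<subseteq> H \<inter> I" "finite S" "card S \<le> n" "generate (adjoint_group R) S = H \<inter> I"
    by blast
  have "card H * card I \<le> card (H \<inter> I) * card (carrier R)"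
    by (rule card_adjoint_subgroup_le[OF fin I H])
  also have "card (carrier R) \<le> (p ^ n) ^ depth p * card I"
    unfolding I_def by (rule card_carrier_le_multiples[OF fin tor])
  finally have "card H * card I \<le> (p ^ (depth p * n) * card (H \<inter> I)) * card I"
    by (simp add: power_mult[symmetric] ac_simps)
  moreover have "0 < card I"
    unfolding card_gt_0_iff using two_sided_idealD(1,2)[OF I] fin finite_subset[of I] by blast
  ultimately have "card H \<le> p ^ (depth p * n) * card (H \<inter> I)"
    by simp
  then obtain S' where S': "S' \<subseteq> H" "finite S'" "card S' \<le> depth p * n" "generate G (S' \<union> (H \<inter> I)) = H"
    using G.generate_over_subgroup[OF p _ _ HI', of a "depth p * n"] finH ca cG by auto
  have "H = generate (adjoint_group R) (S' \<union> (H \<inter> I))"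
    using A.generate_consistent[of "S' \<union> (H \<inter> I)" H] H S'(1,4) unfolding G_def by simp
  also have "\<dots> \<subseteq> generate (adjoint_group R) (S' \<union> S)"
  proof (rule A.generate_subgroup_incl)
    show "subgroup (generate (adjoint_group R) (S' \<union> S)) (adjoint_group R)"
      using S(1) S'(1) subgroup.subset[OF H] by (intro A.generate_is_subgroup) auto
    show "S' \<union> (H \<inter> I) \<subseteq> generate (adjoint_group R) (S' \<union> S)"
      using A.mono_generate[of S "S' \<union> S"] S(4) by (auto intro: generate.incl)
  qed
  finally have "generate (adjoint_group R) (S' \<union> S) = H"
    using A.generate_subgroup_incl[OF _ H, of "S' \<union> S"] S(1) S'(1) by auto
  moreover have "card (S' \<union> S) \<le> (depth p + 1) * n"
    using card_Un_le[of S' S] S(3) S'(3) by (simp add: add_mult_distrib)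
  ultimately show ?thesis
    using S S' by (intro exI[of _ "S' \<union> S"]) auto
qed

end

text \<open>
  The orders of the elements of \<open>R\<^sup>+\<close> are known to be powers of \<open>p\<close> one at a time; in a
  finite ring the sum of their exponents serves all elements at once.
\<close>
lemma p_ring_exponent:
  assumes R: "p_ring p R" and fin: "finite (carrier R)"
  shows "\<exists>m. \<forall>r\<in>carrier R. [(p ^ m :: nat)] \<cdot>\<^bsub>R\<^esub> r = \<zero>\<^bsub>R\<^esub>"
proof -
  interpret rng R
    using R unfolding p_ring_def by simp
  have "\<exists>k. [(p ^ k)] \<cdot>\<^bsub>R\<^esub> r = \<zero>\<^bsub>R\<^esub>" if r: "r \<in> carrier R" for r
  proof -
    obtain k where "add.ord r = p ^ k"
      using R r unfolding p_ring_def p_group_def by auto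
    then show ?thesis
      using add.pow_ord_eq_1[OF r] by metis
  qed
  then obtain k where k: "\<And>r. r \<in> carrier R \<Longrightarrow> [(p ^ k r)] \<cdot>\<^bsub>R\<^esub> r = \<zero>\<^bsub>R\<^esub>"
    by metis
  define m where "m = sum k (carrier R)"
  have "[(p ^ m)] \<cdot>\<^bsub>R\<^esub> r = \<zero>\<^bsub>R\<^esub>" if r: "r \<in> carrier R" for r
  proof -
    have "k r \<le> m"
      unfolding m_def using member_le_sum[OF r, of k] fin by simp
    then have "p ^ m = p ^ k r * p ^ (m - k r)"
      by (simp add: power_add[symmetric])
    then have "[(p ^ m)] \<cdot>\<^bsub>R\<^esub> r = [(p ^ (m - k r))] \<cdot>\<^bsub>R\<^esub> ([(p ^ k r)] \<cdot>\<^bsub>R\<^esub> r)"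
      using r by (simp add: add.nat_pow_pow)
    then show ?thesis
      using k[OF r] by simp
  qed
  then show ?thesis
    by blast
qed

theorem corollaryB:
  fixes p :: nat and R :: "('a, 'b) ring_scheme" and P :: "'a set"
  assumes "Factorial_Ring.prime p"
    and "p_ring p R"
    and "finite (carrier R)"
    and "sylow_subgroup p (adjoint_group R) P"
  shows "prufer_rank ((adjoint_group R)\<lparr>carrier := P\<rparr>)
           \<le> (if p = 2 then 3 else 2) * gen_number (add_monoid R)"
proof -
  interpret rng R
    using assms(2) unfolding p_ring_def by simp
  interpret A: group "adjoint_group R"
    by (rule group_adjoint_group)
  note p = assms(1) and fin = assms(3)
  obtain m where exp: "\<And>r. r \<in> carrier R \<Longrightarrow> [(p ^ m)] \<cdot>\<^bsub>R\<^esub> r = \<zero>\<^bsub>R\<^esub>"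
    using p_ring_exponent[OF assms(2) fin] by blast
  define \<T> where "\<T> = {T. T \<subseteq> carrier R \<and> finite T \<and> generate (add_monoid R) T = carrier R}"
  have gen: "gen_number (add_monoid R) = (INF T\<in>\<T>. enat (card T))"
    unfolding gen_number_def \<T>_def by simp
  have "generate (add_monoid R) (carrier R) = carrier R"
    using add.generate_incl[of "carrier R"] by (auto intro: generate.incl)
  then have "carrier R \<in> \<T>"
    unfolding \<T>_def using fin by simp
  then have "gen_number (add_monoid R) \<in> (\<lambda>T. enat (card T)) ` \<T>"
    unfolding gen by (intro wellorder_InfI) auto
  then obtain T where T: "T \<subseteq> carrier R" "finite T" "generate (add_monoid R) T = carrier R"
    and n: "gen_number (add_monoid R) = enat (card T)"
    unfolding \<T>_def by auto
  have tor: "card (torsion p) \<le> p ^ card T"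
    using card_torsion_le[OF fin _ T(2,1,3)] prime_gt_0_nat[OF p] by blast
  have P: "subgroup P (adjoint_group R)" and cP: "card P = p ^ multiplicity p (Coset.order (adjoint_group R))"
    using assms(4) unfolding sylow_subgroup_def by auto
  interpret P: group "adjoint_group R\<lparr>carrier := P\<rparr>"
    by (rule A.subgroup_imp_group[OF P])
  have finP: "finite P"
    by (rule finite_subset[OF subset_trans[OF subgroup.subset[OF P] adjoint_group_carrier] fin])
  show ?thesis
    unfolding prufer_rank_def
  proof (rule SUP_least, clarify)
    fix H assume H: "subgroup H (adjoint_group R\<lparr>carrier := P\<rparr>)"
    have HA: "subgroup H (adjoint_group R)"
      by (rule A.incl_subgroup[OF P H])
    obtain a where "card H = p ^ a"
      using P.card_subgroup_prime_power[OF p _ _ H] finP cP by auto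
    then obtain S where S: "S \<subseteq> H" "finite S" "card S \<le> (depth p + 1) * card T"
        "generate (adjoint_group R) S = H"
      using adjoint_subgroup_generators[OF p fin exp tor HA] by blast
    have "generate (adjoint_group R\<lparr>carrier := H\<rparr>) S = H"
      using A.generate_consistent[OF S(1) HA] S(4) by simp
    then have "gen_number (adjoint_group R\<lparr>carrier := H\<rparr>) \<le> enat (card S)"
      unfolding gen_number_def using S by (intro INF_lower) auto
    also have "\<dots> \<le> enat ((depth p + 1) * card T)"
      using S(3) by simp
    also have "\<dots> = (if p = 2 then 3 else 2) * gen_number (add_monoid R)"
      unfolding n depth_def by (simp add: numeral_eq_enat)
    finally show "gen_number (adjoint_group R\<lparr>carrier := P, carrier := H\<rparr>)
        \<le> (if p = 2 then 3 else 2) * gen_number (add_monoid R)"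
      by simp
  qed
qed

end
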